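(* The Diophantine equation $x^2 = 57\cdot 2^{n} + 117440512$ has exactly six solutions $(x,n)$ in non-negative integers, namely \[ (x,n)=(10837, 0), (10880,14), (11008,16), (13312,20), (32768,24), (45056,25). \] Similarly, the Diophantine equation $x^2 = 165\cdot 2^{n} + 26404$ has exactly six solutions $(x,n)$ in non-negative integers, namely \[ (x,n)=(163,0), (178,5), (218,7), (262,8), (442,10), (838,12). \] *)

theory Defs
  imports Complex_Main
begin

end

theory Submission
  imports Defs
begin

text \<open>
  Since \<open>117440512 = 7 * 2^24\<close>, the first equation with \<open>n \<ge> 26\<close> would give a square
  congruent to 3 modulo 4 after division by \<open>2^24\<close>.

  In the second equation, fixing the parity of \<open>n\<close> turns it into a Pell-type equation in which
  one unknown is a power of 2. Multiplication by the unit \<open>(13 + sqrt 165) / 2\<close> (\<open>n\<close> even) or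
  \<open>109 + 6 * sqrt 330\<close> (\<open>n\<close> odd) becomes the step \<open>(x, w) \<mapsto> (w, t * w - x)\<close> on the solutions
  of \<open>x^2 - t * x * w + w^2 = c\<close>, where \<open>t\<close> is the trace of the unit. Vieta jumping puts every
  solution on the orbit of one of eight initial ones. Each orbit is periodic modulo
  \<open>2^L * p\<close>, and for suitable \<open>L\<close> and \<open>p\<close> every entry of it that is divisible by \<open>2^L\<close>
  is outside the group generated by 2 modulo \<open>p\<close>; hence the exponents are bounded.
\<close>

section \<open>Vieta jumping\<close>

definition vieta_step :: "int \<Rightarrow> int \<times> int \<Rightarrow> int \<times> int" where
  "vieta_step t = (\<lambda>(x, w). (w, t * w - x))"

text \<open>Stepping back, from \<open>(x, w)\<close> to \<open>(t * x - w, x)\<close>, lowers the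
  first entry until it is no longer positive. Writing that entry as \<open>-a\<close> gives, for
  positive \<open>t\<close>, a sum of nonnegative terms equal to \<open>c\<close>, so only finitely
  many starting pairs are possible.\<close>

lemma vieta_descent:
  fixes x w t c :: int
  assumes "0 < x" "x < w" "x\<^sup>2 - t * x * w + w\<^sup>2 = c" "0 < c"
  shows "\<exists>a b n. 0 \<le> a \<and> 0 < b \<and> a\<^sup>2 + t * a * b + b\<^sup>2 = c \<and> (x, w) = (vieta_step t ^^ n) (-a, b)"
  using assms(1-3)
proof (induction "nat x" arbitrary: x w rule: less_induct)
  case less
  define x' where "x' = t * x - w"
  have step: "(x, w) = vieta_step t (x', x)"
    by (simp add: vieta_step_def x'_def)
  have form: "x'\<^sup>2 - t * x' * x + x\<^sup>2 = c"
    using less.prems(3) by (simp add: x'_def power2_eq_square algebra_simps)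
  show ?case
  proof (cases "x' \<le> 0")
    case True
    then show ?thesis
      using form step less.prems(1) by (intro exI[of _ "-x'"] exI[of _ x] exI[of _ 1]) simp
  next
    case False
    \<comment> \<open>\<open>w\<close> and \<open>x'\<close> are the two roots of \<open>T^2 - t * x * T + x^2 - c\<close>\<close>
    have "w * x' = x\<^sup>2 - c"
      using less.prems(3) by (simp add: x'_def power2_eq_square algebra_simps)
    moreover have "w * x' \<ge> x * x" if "x' \<ge> x"
      using that less.prems by (intro mult_mono) auto
    ultimately have "x' < x"
      using assms(4) by (force simp: power2_eq_square)
    with False less.hyps[of x' x] form obtain a b n where
      "0 \<le> a" "0 < b" "a\<^sup>2 + t * a * b + b\<^sup>2 = c" "(x', x) = (vieta_step t ^^ n) (-a, b)"
      by auto
    with step show ?thesis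
      by (intro exI[of _ a] exI[of _ b] exI[of _ "Suc n"]) simp
  qed
qed

section \<open>Orbits modulo N and the sieve for powers of 2\<close>

fun reduce_pair :: "int \<Rightarrow> int \<times> int \<Rightarrow> int \<times> int" where
  "reduce_pair N (x, w) = (x mod N, w mod N)"

fun vieta_step_mod :: "int \<Rightarrow> int \<Rightarrow> int \<times> int \<Rightarrow> int \<times> int" where
  "vieta_step_mod N t (x, w) = (w, (t * w - x) mod N)"

lemma vieta_step_mod_funpow:
  "(vieta_step_mod N t ^^ n) (reduce_pair N s) = reduce_pair N ((vieta_step t ^^ n) s)"
proof (induction n)
  case (Suc n)
  obtain x w where "(vieta_step t ^^ n) s = (x, w)" by fastforce
  moreover have "(t * (w mod N) - x mod N) mod N = (t * w - x) mod N"
    by (rule mod_diff_cong) (simp_all add: mod_mult_right_eq)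
  ultimately show ?case
    using Suc by (simp add: vieta_step_def)
qed simp

text \<open>Recursion on the step count lets the simplifier check a whole cycle by evaluation. The
  end point \<open>s'\<close> is a separate argument because the current point moves.\<close>

primrec avoiding_cycle :: "('a \<Rightarrow> 'a) \<Rightarrow> ('a \<Rightarrow> bool) \<Rightarrow> 'a \<Rightarrow> nat \<Rightarrow> 'a \<Rightarrow> bool" where
  "avoiding_cycle f Q s' 0 s \<longleftrightarrow> s = s'"
| "avoiding_cycle f Q s' (Suc n) s \<longleftrightarrow> \<not> Q s \<and> avoiding_cycle f Q s' n (f s)"

lemma avoiding_cycle_numeral [simp]:
  "avoiding_cycle f Q s' (numeral k) s \<longleftrightarrow>
     \<not> Q s \<and> avoiding_cycle f Q s' (pred_numeral k) (f s)"
  by (simp add: numeral_eq_Suc)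

text \<open>The orbit returns to \<open>s\<close> after \<open>P\<close> steps, so \<open>n\<close>
  may be replaced by \<open>n mod P\<close>, one of the positions checked.\<close>

lemma avoiding_cycleD:
  assumes "avoiding_cycle f Q s P s" "0 < P"
  shows "\<not> Q ((f ^^ n) s)"
proof -
  have "(f ^^ P) s = s' \<and> (\<forall>i<P. \<not> Q ((f ^^ i) s))" if "avoiding_cycle f Q s' P s" for s s'
    using that
  proof (induction P arbitrary: s)
    case (Suc P)
    then have "\<not> Q ((f ^^ i) s)" if "i < Suc P" for i
      using that by (cases i) (auto simp: funpow_swap1)
    with Suc show ?case by (auto simp: funpow_swap1)
  qed simp
  from this[OF assms(1)] show ?thesis
    using assms(2) funpow_mod_eq[of P f s n] by (metis mod_less_divisor)
qed

definition double_mod :: "int \<Rightarrow> int \<Rightarrow> int" where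
  "double_mod p y = 2 * y mod p"

lemma double_mod_funpow:
  assumes "1 < p"
  shows "(double_mod p ^^ n) 1 = 2 ^ n mod p"
  using assms by (induction n) (simp_all add: double_mod_def mod_mult_right_eq)

text \<open>The conditional, unlike a conjunction, keeps the simplifier from evaluating the second
  test when the first one fails.\<close>

definition maybe_power_of_2 :: "nat \<Rightarrow> nat \<Rightarrow> int \<Rightarrow> int \<times> int \<Rightarrow> bool" where
  "maybe_power_of_2 L q p s \<longleftrightarrow>
     (if fst s mod 2 ^ L = 0 then \<not> avoiding_cycle (double_mod p) ((=) (fst s mod p)) 1 q 1
      else False)"

lemma maybe_power_of_2I:
  assumes "fst s mod 2 ^ L = 0" "fst s mod p = 2 ^ e mod p" "1 < p" "0 < q"
  shows "maybe_power_of_2 L q p s"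
  using assms avoiding_cycleD[of "double_mod p" "(=) (fst s mod p)" 1 q e]
  by (auto simp: maybe_power_of_2_def double_mod_funpow)

definition sieve :: "int \<Rightarrow> int \<times> int \<Rightarrow> nat \<Rightarrow> nat \<Rightarrow> int \<Rightarrow> nat \<Rightarrow> bool" where
  "sieve t s L q p P \<longleftrightarrow>
     0 < P \<and> 0 < q \<and> 1 < p \<and>
     avoiding_cycle (vieta_step_mod (2 ^ L * p) t) (maybe_power_of_2 L q p)
       (reduce_pair (2 ^ L * p) s) P (reduce_pair (2 ^ L * p) s)"

lemma sieve_not_power_of_2:
  assumes "sieve t s L q p P" "L \<le> e"
  shows "fst ((vieta_step t ^^ n) s) \<noteq> 2 ^ e"
proof
  define x where "x = fst ((vieta_step t ^^ n) s)"
  assume "fst ((vieta_step t ^^ n) s) = 2 ^ e"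
  then have x: "x = 2 ^ e" by (simp add: x_def)
  define N where "N = 2 ^ L * p"
  define r where "r = (vieta_step_mod N t ^^ n) (reduce_pair N s)"
  have r: "fst r = x mod N"
    by (cases "(vieta_step t ^^ n) s") (simp add: r_def x_def vieta_step_mod_funpow)
  have "\<not> maybe_power_of_2 L q p r"
    unfolding r_def using assms(1) by (intro avoiding_cycleD[of _ _ _ P])
      (simp_all add: sieve_def N_def)
  moreover have "fst r mod 2 ^ L = 0"
    using assms(2) by (simp add: r N_def x mod_mod_cancel le_imp_power_dvd)
  moreover have "fst r mod p = 2 ^ e mod p"
    by (simp add: r N_def x mod_mod_cancel)
  ultimately show False
    using assms(1) maybe_power_of_2I by (auto simp: sieve_def)
qed

section \<open>Integer square roots and the initial pairs\<close>

text \<open>The list \<open>rs\<close> holds the rounded-down square roots of \<open>f 0\<close>,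
  \<open>f 1\<close>, ..., so \<open>rs ! n\<close> is the only candidate for \<open>x\<close>. For
  concrete lists the last hypothesis is settled by evaluation.\<close>

lemma square_eq_bounded:
  fixes x n :: nat and rs :: "nat list"
  assumes "x\<^sup>2 = f n" "n < length rs"
    and "list_all2 (\<lambda>n s. s\<^sup>2 \<le> f n \<and> f n < (Suc s)\<^sup>2 \<and> (s\<^sup>2 = f n \<longrightarrow> Q s n)) [0..<length rs] rs"
  shows "Q x n"
proof -
  have rs: "(rs ! n)\<^sup>2 \<le> x\<^sup>2" "x\<^sup>2 < (Suc (rs ! n))\<^sup>2" "(rs ! n)\<^sup>2 = x\<^sup>2 \<longrightarrow> Q (rs ! n) n"
    using list_all2_nthD[OF assms(3), of n] assms(1,2) by simp_all
  then have "rs ! n \<le> x" "x < Suc (rs ! n)"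
    by (simp, blast intro: power_less_imp_less_base)
  then have "x = rs ! n" by simp
  with rs(3) show ?thesis by simp
qed

text \<open>By symmetry the smaller entry may come first. It is then bounded, and the discriminant
  of the quadratic in the larger entry must be a square.\<close>

lemma vieta_base_13:
  fixes a b :: int
  assumes "0 \<le> a" "0 \<le> b" "a\<^sup>2 + 13 * a * b + b\<^sup>2 = 6601"
  shows "(a, b) \<in> {(1, 75), (3, 64), (13, 32), (16, 27), (27, 16), (32, 13), (64, 3), (75, 1)}"
proof -
  have *: "(m, k) \<in> {(1, 75), (3, 64), (13, 32), (16, 27)}" (is "_ \<in> ?S")
    if "0 \<le> m" "m \<le> k" "m\<^sup>2 + 13 * m * k + k\<^sup>2 = 6601" for m k :: int
  proof -
    have "m * m \<le> m * k" "m\<^sup>2 \<le> k\<^sup>2"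
      using that by (auto intro!: mult_left_mono power_mono)
    \<comment> \<open>\<open>15 * m^2 <= 6601 < 15 * 21^2\<close>.\<close>
    then have "m\<^sup>2 < 21\<^sup>2"
      using that(3) by (simp add: power2_eq_square mult.assoc)
    then have "nat m < 21"
      using power_less_imp_less_base[of m 2 21] by simp
    \<comment> \<open>Completing the square in \<open>k\<close>, with \<open>13^2 - 4 = 165\<close>
      and \<open>4 * 6601 = 26404\<close>.\<close>
    define x where "x = nat (2 * k + 13 * m)"
    have "int (x\<^sup>2) = int (165 * (nat m)\<^sup>2 + 26404)"
      using that by (simp add: x_def power2_eq_square algebra_simps)
    then have "x\<^sup>2 = 165 * (nat m)\<^sup>2 + 26404"
      by (rule of_nat_eq_iff[THEN iffD1])
    then have "(nat m, x) \<in> {(1, 163), (3, 167), (13, 233), (16, 262)}"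
      using \<open>nat m < 21\<close>
      by (intro square_eq_bounded[where f = "\<lambda>n. 165 * n\<^sup>2 + 26404" and Q = "\<lambda>x n. (n, x) \<in> _" and rs =
          "[162, 163, 164, 167, 170, 174, 179, 185, 192, 199, 207, 215, 223, 233, 242, 252,
           262, 272, 282, 293, 303]"])
        (simp_all, simp flip: One_nat_def)
    then show ?thesis
      using that by (auto simp: x_def)
  qed
  have "(a, b) \<in> ?S \<or> (b, a) \<in> ?S"
  proof (cases "a \<le> b")
    case True
    then have "(a, b) \<in> ?S"
      using assms by (intro *) simp_all
    then show ?thesis ..
  next
    case False
    then have "(b, a) \<in> ?S"
      using assms by (intro *) (simp_all add: algebra_simps)
    then show ?thesis ..
  qed
  then show ?thesis by auto
qed

lemma vieta_base_218:
  fixes a b :: int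
  assumes "0 \<le> a" "0 \<le> b" "a\<^sup>2 + 218 * a * b + b\<^sup>2 = 237636"
  shows "(a, b) \<in> {(2, 316), (4, 218), (10, 104), (30, 36), (36, 30), (104, 10), (218, 4), (316, 2)}"
proof -
  have *: "(m, k) \<in> {(2, 316), (4, 218), (10, 104), (30, 36)}" (is "_ \<in> ?S")
    if "0 \<le> m" "m \<le> k" "m\<^sup>2 + 218 * m * k + k\<^sup>2 = 237636" for m k :: int
  proof -
    \<comment> \<open>\<open>237636 = 36 * 6601\<close> and \<open>218 - 2 = 6 * 36\<close>\<close>
    have sq: "(m + k)\<^sup>2 = 6\<^sup>2 * (6601 - 6 * m * k)"
      using that(3) by (simp add: power2_eq_square algebra_simps)
    then have "6 dvd m + k"
      by (metis dvd_triv_left pow_divides_pow_iff zero_less_numeral)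
    then obtain h where "m + k = 6 * h" by blast
    then have k: "k = 6 * h - m" by simp
    have h: "h\<^sup>2 + 6 * m * k = 6601"
      using that(3) unfolding k by (simp add: power2_eq_square algebra_simps)
    have "m * m \<le> m * k" "m\<^sup>2 \<le> k\<^sup>2"
      using that by (auto intro!: mult_left_mono power_mono)
    \<comment> \<open>\<open>220 * m^2 <= 237636 < 220 * 33^2\<close>.\<close>
    then have "m\<^sup>2 < 33\<^sup>2"
      using that(3) by (simp add: power2_eq_square mult.assoc)
    then have "nat m < 33"
      using power_less_imp_less_base[of m 2 33] by simp
    \<comment> \<open>This is \<open>(k + 109 * m) / 6\<close>, from completing the square in
      \<open>k\<close>, with \<open>109^2 - 1 = 36 * 330\<close>.\<close>
    define x where "x = nat (h + 18 * m)"
    have "int (x\<^sup>2) = int (330 * (nat m)\<^sup>2 + 6601)"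
      using that(1,2) h k by (simp add: x_def power2_eq_square algebra_simps)
    then have "x\<^sup>2 = 330 * (nat m)\<^sup>2 + 6601"
      by (rule of_nat_eq_iff[THEN iffD1])
    then have "(nat m, x) \<in> {(2, 89), (4, 109), (10, 199), (30, 551)}"
      using \<open>nat m < 33\<close>
      by (intro square_eq_bounded[where f = "\<lambda>n. 330 * n\<^sup>2 + 6601" and Q = "\<lambda>x n. (n, x) \<in> _" and rs =
          "[81, 83, 89, 97, 109, 121, 135, 150, 166, 182, 199, 215, 232, 249, 266, 284, 301,
           319, 336, 354, 372, 390, 407, 425, 443, 461, 479, 497, 515, 533, 551, 568, 586]"])
        (simp_all, simp flip: One_nat_def)
    then show ?thesis
      using that by (auto simp: x_def k)
  qed
  have "(a, b) \<in> ?S \<or> (b, a) \<in> ?S"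
  proof (cases "a \<le> b")
    case True
    then have "(a, b) \<in> ?S"
      using assms by (intro *) simp_all
    then show ?thesis ..
  next
    case False
    then have "(b, a) \<in> ?S"
      using assms by (intro *) (simp_all add: algebra_simps)
    then show ?thesis ..
  qed
  then show ?thesis by auto
qed

section \<open>Sieving the sixteen orbits\<close>

text \<open>The parameters come from a computer search; \<open>q\<close> is a multiple of the order of 2 modulo \<open>p\<close>,
  and \<open>P\<close> is a period of the orbit modulo \<open>2^L * p\<close>.\<close>

lemma sieve_13:
  "sieve 13 (-1, 75) 0 3 7 3" "sieve 13 (-3, 64) 7 39 79 96"
  "sieve 13 (-13, 32) 6 9 73 48" "sieve 13 (-16, 27) 0 3 7 3"
  "sieve 13 (-27, 16) 5 9 73 24" "sieve 13 (-32, 13) 0 3 7 3"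
  "sieve 13 (-64, 3) 0 3 7 3" "sieve 13 (-75, 1) 1 7 127 9"
  by (simp_all add: sieve_def maybe_power_of_2_def double_mod_def)

lemma sieve_218:
  "sieve 218 (-2, 316) 0 9 73 3" "sieve 218 (-4, 218) 0 9 73 3"
  "sieve 218 (-10, 104) 0 9 73 3" "sieve 218 (-30, 36) 0 2 3 1"
  "sieve 218 (-36, 30) 0 2 3 1" "sieve 218 (-104, 10) 0 9 73 3"
  "sieve 218 (-218, 4) 3 28 113 16" "sieve 218 (-316, 2) 2 3 7 6"
  by (simp_all add: sieve_def maybe_power_of_2_def double_mod_def)

text \<open>The bound 7 is the largest \<open>L\<close> in \<open>sieve_13\<close>; from there on
  all eight sieves apply.\<close>

lemma vieta_13_no_power_of_2:
  assumes "2 ^ e < w" "(2 ^ e)\<^sup>2 - 13 * 2 ^ e * w + w\<^sup>2 = (6601 :: int)"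
  shows "e < 7"
proof (rule ccontr)
  assume e: "\<not> e < 7"
  obtain a b n where ab: "0 \<le> a" "0 < b" "a\<^sup>2 + 13 * a * b + b\<^sup>2 = 6601"
    and n: "(2 ^ e, w) = (vieta_step 13 ^^ n) (-a, b)"
    using vieta_descent[of "2 ^ e" w 13 6601] assms by auto
  have "fst ((vieta_step 13 ^^ n) (-a, b)) \<noteq> 2 ^ e"
    using vieta_base_13[OF ab(1) less_imp_le[OF ab(2)] ab(3)]
      sieve_13[THEN sieve_not_power_of_2, of e n] e
    by auto
  then show False by (simp flip: n)
qed

text \<open>Likewise, 3 is the largest \<open>L\<close> in \<open>sieve_218\<close>.\<close>

lemma vieta_218_no_power_of_2:
  assumes "2 ^ e < w" "(2 ^ e)\<^sup>2 - 218 * 2 ^ e * w + w\<^sup>2 = (237636 :: int)"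
  shows "e < 3"
proof (rule ccontr)
  assume e: "\<not> e < 3"
  obtain a b n where ab: "0 \<le> a" "0 < b" "a\<^sup>2 + 218 * a * b + b\<^sup>2 = 237636"
    and n: "(2 ^ e, w) = (vieta_step 218 ^^ n) (-a, b)"
    using vieta_descent[of "2 ^ e" w 218 237636] assms by auto
  have "fst ((vieta_step 218 ^^ n) (-a, b)) \<noteq> 2 ^ e"
    using vieta_base_218[OF ab(1) less_imp_le[OF ab(2)] ab(3)]
      sieve_218[THEN sieve_not_power_of_2, of e n] e
    by auto
  then show False by (simp flip: n)
qed

section \<open>Bounds on the exponents and the solutions\<close>

lemma exponent_bound_165:
  fixes x n :: nat
  assumes "x\<^sup>2 = 165 * 2 ^ n + 26404"
  shows "n < 14"
proof (rule ccontr)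
  assume n: "\<not> n < 14"
  have eq: "(int x)\<^sup>2 = 165 * 2 ^ n + 26404"
    using arg_cong[OF assms, of int] by simp
  show False
  proof (cases "even n")
    case True
    define X :: int where "X = 2 ^ (n div 2)"
    have X: "X\<^sup>2 = 2 ^ n"
      using True by (simp add: X_def flip: power_mult)
    have "even X" "0 < X"
      using n by (simp_all add: X_def)
    have "even ((int x)\<^sup>2)"
      unfolding eq using n by simp
    then have "even (int x + 13 * X)"
      using \<open>even X\<close> by simp
    \<comment> \<open>Multiplying \<open>(x + X * sqrt 165) / 2\<close> by the unit
      \<open>(13 + sqrt 165) / 2\<close> turns \<open>X\<close> into \<open>w\<close>.\<close>
    then obtain w where "int x + 13 * X = 2 * w" by blast
    then have x: "int x = 2 * w - 13 * X" by simp
    have "X < w"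
      using x \<open>0 < X\<close> by linarith
    moreover have "X\<^sup>2 - 13 * X * w + w\<^sup>2 = 6601"
      using eq unfolding x by (simp add: power2_eq_square algebra_simps flip: X)
    ultimately have "n div 2 < 7"
      unfolding X_def by (rule vieta_13_no_power_of_2)
    then show False using n by simp
  next
    case False
    \<comment> \<open>With \<open>2^n = 8 * Z^2\<close> the equation becomes
      \<open>(x / 2)^2 = 330 * Z^2 + 6601\<close>, and the unit \<open>109 + 6 * sqrt 330\<close>
      turns \<open>Z\<close> into \<open>3 * x + 109 * Z\<close>.\<close>
    define e where "e = (n - 3) div 2"
    define Z :: int where "Z = 2 ^ e"
    have "n = e * 2 + 3"
      using False n unfolding e_def by presburger
    then have Z: "8 * Z\<^sup>2 = 2 ^ n"
      by (simp add: Z_def power_add flip: power_mult)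
    have "0 < Z"
      by (simp add: Z_def)
    then have "Z < 3 * int x + 109 * Z"
      by linarith
    moreover have "Z\<^sup>2 - 218 * Z * (3 * int x + 109 * Z) + (3 * int x + 109 * Z)\<^sup>2 = 237636"
      using eq by (simp add: power2_eq_square algebra_simps flip: Z)
    ultimately have "e < 3"
      unfolding Z_def by (rule vieta_218_no_power_of_2)
    then show False using n \<open>n = e * 2 + 3\<close> by simp
  qed
qed

lemma exponent_bound_57:
  fixes x n :: nat
  assumes "x\<^sup>2 = 57 * 2 ^ n + 117440512"
  shows "n < 26"
proof (rule ccontr)
  assume "\<not> n < 26"
  then obtain k where n: "n = 26 + k"
    using le_Suc_ex not_less by blast
  have x: "x\<^sup>2 = (2 ^ 12)\<^sup>2 * (57 * 2 ^ (k + 2) + 7)"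
    using assms by (simp add: n power_add)
  then have "2 ^ 12 dvd x"
    by (metis dvd_triv_left pow_divides_pow_iff zero_less_numeral)
  then obtain y where "x = 2 ^ 12 * y" by blast
  with x have "y\<^sup>2 = 4 * (57 * 2 ^ k + 1) + 3"
    by (simp add: power_mult_distrib)
  then have "y\<^sup>2 mod 4 = 3"
    by presburger
  moreover have "y\<^sup>2 mod 4 = (y mod 4)\<^sup>2 mod 4" by (simp add: power_mod)
  moreover have "y mod 4 \<in> {0, 1, 2, 3}" by auto
  ultimately show False by auto
qed

lemma solutions_57:
  fixes x n :: nat
  assumes "x\<^sup>2 = 57 * 2 ^ n + 117440512"
  shows "(x, n) \<in> {(10837, 0), (10880, 14), (11008, 16), (13312, 20), (32768, 24), (45056, 25)}"
    (is "_ \<in> ?S")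
  using assms exponent_bound_57[OF assms]
  by (intro square_eq_bounded[where f = "\<lambda>n. 57 * 2 ^ n + 117440512" and Q = "\<lambda>x n. (x, n) \<in> ?S" and rs =
      "[10837, 10837, 10837, 10837, 10837, 10837, 10837, 10837, 10837, 10838, 10839, 10842,
       10847, 10858, 10880, 10922, 11008, 11176, 11505, 12137, 13312, 15394, 18881, 24404,
       32768, 45056]"])
    simp_all

lemma solutions_165:
  fixes x n :: nat
  assumes "x\<^sup>2 = 165 * 2 ^ n + 26404"
  shows "(x, n) \<in> {(163, 0), (178, 5), (218, 7), (262, 8), (442, 10), (838, 12)}"
    (is "_ \<in> ?S")
  using assms exponent_bound_165[OF assms]
  by (intro square_eq_bounded[where f = "\<lambda>n. 165 * 2 ^ n + 26404" and Q = "\<lambda>x n. (x, n) \<in> ?S" and rs =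
      "[163, 163, 164, 166, 170, 178, 192, 218, 262, 332, 442, 603, 838, 1173]"])
    simp_all

theorem theorem2p4:
  shows "{(x :: nat, n :: nat). x ^ 2 = 57 * 2 ^ n + 117440512} =
           {(10837, 0), (10880, 14), (11008, 16), (13312, 20), (32768, 24), (45056, 25)} \<and>
         {(x :: nat, n :: nat). x ^ 2 = 165 * 2 ^ n + 26404} =
           {(163, 0), (178, 5), (218, 7), (262, 8), (442, 10), (838, 12)}"
  using solutions_57 solutions_165 by auto

end
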